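(* Let $n$ be a positive integer. Then $n$ is the sum of pairwise distinct odd positive integers whose product is a square if and only if $n\in\{9,10\}$, or $n\geq 23$ and $n\notin\{27,28,29,36,37,38,42,43,44,45,46,52,53,54,62,67,68\}$.
   Context: A sum with a single summand is allowed (for example $9=9$, with product $9=3^2$), and a square means the square of an integer.
   Formalization: The value n = 1 is added to the list of representable integers, because 1 = 1 is a sum with a single odd summand whose product is 1 = 1^2; for n ≥ 2 the equivalence is unchanged. *)

theory Defs
  imports Main "HOL-Computational_Algebra.Nth_Powers"
begin

(* The empty set satisfies this for n = 0 only. Odd natural numbers are positive, and
   for a natural number being a square in nat is the same as being a square in int. *)
definition sum_of_distinct_odds_with_square_product :: "nat \<Rightarrow> bool" where
  "sum_of_distinct_odds_with_square_product n \<longleftrightarrow>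
     (\<exists>A :: nat set. finite A \<and> (\<forall>a\<in>A. odd a) \<and> \<Sum>A = n \<and> is_square (\<Prod>A))"

(* The single summand 1 = 1^2 represents 1, so a characterisation of all positive n
   has to list n = 1. *)
lemma sum_of_distinct_odds_with_square_product_1:
  "sum_of_distinct_odds_with_square_product 1"
  unfolding sum_of_distinct_odds_with_square_product_def
  by (rule exI[of _ "{1}"]) simp

end

theory Submission
  imports Defs "HOL-Computational_Algebra.Squarefree" "HOL-Library.Code_Binary_Nat"
begin

(* Necessity, and sufficiency for n < 150, is a finite search over sets of odd numbers. A partial
   choice only matters through its sum and the squarefree part p of its product, and it can be
   dropped as soon as p does not divide the product of the squarefree parts of the candidates that
   are left; this makes the search small. For larger n one induction suffices: if every n in
   [69, 69 + k^2) is represented by odd numbers below k^2, where k >= 9 is odd, then adding the new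
   summand k^2 represents every n in [69 + k^2, 69 + 2 k^2), and (k + 2)^2 <= 2 k^2. *)

subsection \<open>Squarefree parts of products\<close>

text \<open>The square of \<open>gcd p r\<close> splits off from \<open>p * r\<close> without
  affecting squareness. For squarefree \<open>p\<close> and \<open>r\<close> the remaining cofactor
  is the squarefree part of \<open>p * r\<close>, which gives the update rule of the search.\<close>

lemma is_square_mult_div_gcd:
  fixes p r x :: nat
  assumes "p > 0"
  shows "is_square (p * (r * x)) \<longleftrightarrow> is_square (p div gcd p r * (r div gcd p r) * x)"
proof -
  have "p * (r * x) = (gcd p r * (p div gcd p r)) * ((gcd p r * (r div gcd p r)) * x)"
    by simp
  also have "\<dots> = (gcd p r)\<^sup>2 * (p div gcd p r * (r div gcd p r) * x)"
    by (simp only: power2_eq_square mult_ac)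
  finally show ?thesis
    using assms is_nth_power_mult_cancel_left[of 2 "(gcd p r)\<^sup>2"] by (simp only:) simp
qed

lemma is_square_mult_square_right:
  fixes p r k x :: nat
  assumes "k > 0"
  shows "is_square (p * (r * k\<^sup>2 * x)) \<longleftrightarrow> is_square (p * (r * x))"
proof -
  have "p * (r * k\<^sup>2 * x) = k\<^sup>2 * (p * (r * x))"
    by (simp only: mult_ac)
  then show ?thesis
    using assms is_nth_power_mult_cancel_left[of 2 "k\<^sup>2"] by (simp only:) simp
qed

lemma squarefree_div:
  fixes p d :: nat
  assumes "squarefree p" "d dvd p"
  shows "squarefree (p div d)"
  using assms squarefree_mono[of "p div d" p] by (metis dvd_div_mult_self dvd_triv_left)

lemma squarefree_mult_div_gcd:
  fixes p r :: nat
  assumes "squarefree p" "squarefree r"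
  shows "squarefree (p div gcd p r * (r div gcd p r))"
proof (rule squarefree_mult_coprime)
  have "p \<noteq> 0"
    using assms by (intro notI) simp
  then show "coprime (p div gcd p r) (r div gcd p r)"
    by (intro div_gcd_coprime) simp
  show "squarefree (p div gcd p r)" "squarefree (r div gcd p r)"
    using assms by (auto intro: squarefree_div)
qed

lemma squarefree_is_square_nat_iff:
  fixes p :: nat
  assumes "squarefree p"
  shows "is_square p \<longleftrightarrow> p = 1"
proof
  assume "is_square p"
  then obtain m where "p = m\<^sup>2"
    by (rule is_nth_powerE)
  then show "p = 1"
    using assms squarefreeD[of p m] by simp
qed simp

text \<open>After division by the gcd, two coprime factors have a square product, so each is a
  square. The cofactor of \<open>p\<close> is also squarefree, hence 1. This justifies the
  divisibility test in the search.\<close>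

lemma squarefree_dvd_of_is_square_mult:
  fixes p x :: nat
  assumes "squarefree p" "is_square (p * x)"
  shows "p dvd x"
proof -
  have pos: "p > 0"
    using assms by (intro gr0I) simp
  have "is_square (p div gcd p x * (x div gcd p x))"
    using assms(2) is_square_mult_div_gcd[of p x 1] pos by simp
  moreover have "coprime (p div gcd p x) (x div gcd p x)"
    using pos by (intro div_gcd_coprime) simp
  ultimately have "is_square (p div gcd p x)"
    by (simp add: is_nth_power_mult_coprime_nat_iff)
  moreover have "squarefree (p div gcd p x)"
    using assms(1) by (auto intro: squarefree_div)
  ultimately have "p div gcd p x = 1"
    by (simp add: squarefree_is_square_nat_iff)
  then have "p = gcd p x"
    by (metis dvd_mult_div_cancel gcd_dvd1 mult.right_neutral)
  then show ?thesis
    by (metis gcd_dvd2)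
qed

text \<open>If the square of m divides an odd r < 121 = 11^2, then m is odd and below 11, so m is 1,
  3, 5, 7 or 9. The value 9 falls with 3, since 9 divides 81.\<close>

lemma squarefree_odd_less_121:
  fixes r :: nat
  assumes "odd r" "r < 121" "\<not> 9 dvd r" "\<not> 25 dvd r" "\<not> 49 dvd r"
  shows "squarefree r"
proof (rule squarefreeI)
  fix m assume m: "m\<^sup>2 dvd r"
  have "r > 0"
    using assms(1) by (intro gr0I) simp
  then have "m\<^sup>2 \<le> r"
    using m by (simp add: dvd_imp_le)
  then have "m\<^sup>2 < 11\<^sup>2"
    using assms(2) by simp
  then have "m < 11"
    by (rule power_less_imp_less_base) simp
  then have "m \<in> set [0..<11]"
    by simp
  moreover have "odd m"
    using m assms(1) by (metis dvd_trans even_power zero_less_numeral)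
  moreover have "\<forall>j\<in>set [0..<11]. odd j \<longrightarrow> j \<in> {1, 3, 5, 7, 9 :: nat}"
    by code_simp
  ultimately have "m \<in> {1, 3, 5, 7, 9}"
    by blast
  moreover have "m \<noteq> 9"
    using m assms(3) dvd_trans[of 9 81 r] by auto
  ultimately show "m dvd 1"
    using m assms by auto
qed

subsection \<open>The search\<close>

(* The pair (r, k) with r squarefree encodes the number r * k^2. *)
definition val :: "nat \<times> nat \<Rightarrow> nat" where
  "val x = fst x * (snd x)\<^sup>2"

definition squarefree_pair :: "nat \<times> nat \<Rightarrow> bool" where
  "squarefree_pair x \<longleftrightarrow> squarefree (fst x) \<and> snd x > 0"

text \<open>The state is the squarefree part \<open>p\<close> of the product and the sum
  \<open>s\<close> of the numbers chosen so far; \<open>N\<close> caps the sum. At the end of the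
  list, the chosen product is a square exactly when \<open>p\<close> is 1.\<close>

fun square_sums :: "nat \<Rightarrow> (nat \<times> nat) list \<Rightarrow> nat \<Rightarrow> nat \<Rightarrow> nat list" where
  "square_sums N [] p s = (if p = 1 then [s] else [])"
| "square_sums N ((r, k) # xs) p s =
     (if p dvd r * prod_list (map fst xs) then
        square_sums N xs p s @
        (if s + r * k\<^sup>2 \<le> N
         then square_sums N xs (p div gcd p r * (r div gcd p r)) (s + r * k\<^sup>2) else [])
      else [])"

lemma ex_subset_insert:
  "(\<exists>B. B \<subseteq> insert x S \<and> P B) \<longleftrightarrow>
    (\<exists>B. B \<subseteq> S \<and> P B) \<or> (\<exists>B. B \<subseteq> S \<and> P (insert x B))"
  by (metis (no_types) insert_mono subset_insert subset_insertI2 subset_insert_iff insert_Diff)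

text \<open>The pruning is sound: the square parts of the chosen numbers cancel, so \<open>p\<close>
  must divide the product of their squarefree parts, and this divides the product over all remaining
  candidates.\<close>

lemma squarefree_dvd_prod_fst:
  assumes "squarefree p" "distinct xs" "\<forall>x\<in>set xs. squarefree_pair x"
    and B: "B \<subseteq> set xs" "is_square (p * prod val B)"
  shows "p dvd prod_list (map fst xs)"
proof -
  have "prod val B = prod fst B * (prod snd B)\<^sup>2"
    by (simp add: val_def prod.distrib prod_power_distrib)
  moreover have "prod snd B > 0"
    using assms by (intro prod_pos) (auto simp: squarefree_pair_def)
  ultimately have "is_square (p * prod fst B)"
    using B(2) is_square_mult_square_right[of "prod snd B" p "prod fst B" 1] by simp
  then have "p dvd prod fst B"
    using assms(1) squarefree_dvd_of_is_square_mult by blast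
  also have "prod fst B dvd prod fst (set xs)"
    using B(1) by (intro prod_dvd_prod_subset) auto
  also have "\<dots> = prod_list (map fst xs)"
    using assms(2) by (simp add: prod.distinct_set_conv_list)
  finally show ?thesis .
qed

text \<open>Correctness of the search from an arbitrary state, as the induction needs: the subsets
  are split by whether they contain the head of the list.\<close>

lemma set_square_sums:
  assumes "squarefree p" "distinct xs" "\<forall>x\<in>set xs. squarefree_pair x" "s \<le> N"
  shows "t \<in> set (square_sums N xs p s) \<longleftrightarrow>
    (\<exists>B. B \<subseteq> set xs \<and> t = s + sum val B \<and> t \<le> N \<and> is_square (p * prod val B))"
  using assms
proof (induction xs arbitrary: p s)
  case Nil
  then show ?case
    by (auto simp: squarefree_is_square_nat_iff)
next
  case (Cons x xs)
  obtain r k where x: "x = (r, k)"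
    by (cases x)
  let ?Q = "\<lambda>B. t = s + sum val B \<and> t \<le> N \<and> is_square (p * prod val B)"
  show ?case
  proof (cases "p dvd r * prod_list (map fst xs)")
    case False
    then have "\<not> p dvd prod_list (map fst (x # xs))"
      by (simp add: x)
    then show ?thesis
      using False squarefree_dvd_prod_fst[OF Cons.prems(1-3)] x by auto
  next
    case True
    let ?m = "p div gcd p r * (r div gcd p r)"
    have sf: "squarefree r" "k > 0" and "p > 0"
      using Cons.prems by (auto simp: x squarefree_pair_def intro!: gr0I)
    have m: "squarefree ?m"
      using Cons.prems(1) sf(1) by (rule squarefree_mult_div_gcd)
    \<comment> \<open>The factor \<open>k\<^sup>2\<close> has no effect on squareness, and
      \<open>p * r\<close> may be replaced by its squarefree part \<open>?m\<close>.\<close>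
    have insert_x: "?Q (insert x B) \<longleftrightarrow>
        t = (s + r * k\<^sup>2) + sum val B \<and> t \<le> N \<and> is_square (?m * prod val B)"
      if "B \<subseteq> set xs" for B
    proof -
      have "x \<notin> B" "finite B"
        using that Cons.prems(2) finite_subset by auto
      then show ?thesis
        using is_square_mult_square_right[OF sf(2)] is_square_mult_div_gcd[OF \<open>p > 0\<close>]
        by (simp add: x val_def add.assoc)
    qed
    have skip: "t \<in> set (square_sums N xs p s) \<longleftrightarrow> (\<exists>B. B \<subseteq> set xs \<and> ?Q B)"
      using Cons by simp
    have take: "t \<in> set (if s + r * k\<^sup>2 \<le> N then square_sums N xs ?m (s + r * k\<^sup>2) else [])
        \<longleftrightarrow> (\<exists>B. B \<subseteq> set xs \<and> ?Q (insert x B))"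
    proof (cases "s + r * k\<^sup>2 \<le> N")
      case True
      then show ?thesis
        using Cons.IH[OF m, of "s + r * k\<^sup>2"] Cons.prems(2,3) insert_x by auto
    next
      \<comment> \<open>Sums only grow, so no set containing \<open>x\<close> stays within
        \<open>N\<close>.\<close>
      case False
      then show ?thesis
        using insert_x by auto
    qed
    have "t \<in> set (square_sums N (x # xs) p s) \<longleftrightarrow>
        (\<exists>B. B \<subseteq> set xs \<and> ?Q B) \<or> (\<exists>B. B \<subseteq> set xs \<and> ?Q (insert x B))"
      unfolding x square_sums.simps using True skip take x by auto
    also have "\<dots> \<longleftrightarrow> (\<exists>B. B \<subseteq> set (x # xs) \<and> ?Q B)"
      by (simp only: list.set ex_subset_insert)
    finally show ?thesis .
  qed
qed

lemma in_square_sums_iff: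
  assumes "distinct (map val xs)" "\<forall>x\<in>set xs. squarefree_pair x"
  shows "t \<in> set (square_sums N xs 1 0) \<longleftrightarrow>
    (\<exists>A. A \<subseteq> val ` set xs \<and> t = \<Sum>A \<and> t \<le> N \<and> is_square (\<Prod>A))"
proof -
  have inj: "inj_on val (set xs)" and "distinct xs"
    using assms(1) by (auto simp: distinct_map)
  have "t \<in> set (square_sums N xs 1 0) \<longleftrightarrow>
      (\<exists>B. B \<subseteq> set xs \<and> t = sum val B \<and> t \<le> N \<and> is_square (prod val B))"
    using set_square_sums[of 1 xs 0 N t] \<open>distinct xs\<close> assms(2) by simp
  also have "\<dots> \<longleftrightarrow>
      (\<exists>B. B \<subseteq> set xs \<and> t = \<Sum>(val ` B) \<and> t \<le> N \<and> is_square (\<Prod>(val ` B)))"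
    using inj by (metis (no_types, lifting) inj_on_subset prod.reindex_cong sum.reindex_cong)
  also have "\<dots> \<longleftrightarrow>
      (\<exists>A. A \<subseteq> val ` set xs \<and> t = \<Sum>A \<and> t \<le> N \<and> is_square (\<Prod>A))"
    by (metis (no_types, lifting) image_mono subset_imageE)
  finally show ?thesis .
qed

(* The candidates are sorted by decreasing largest prime factor of the squarefree part, so that
   the divisibility test rejects early. *)
definition odds_below_69 :: "(nat \<times> nat) list" where
  "odds_below_69 =
    [(67, 1), (61, 1), (59, 1), (53, 1), (47, 1), (43, 1), (41, 1), (37, 1), (31, 1), (29, 1),
     (23, 1), (57, 1), (19, 1), (51, 1), (17, 1), (65, 1), (39, 1), (13, 1), (55, 1), (33, 1),
     (11, 1), (7, 3), (35, 1), (21, 1), (7, 1), (5, 3), (15, 1), (5, 1), (3, 3), (3, 1),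
     (1, 7), (1, 5), (1, 3), (1, 1)]"

(* A minimal set of odd numbers below 81 that represents all of [69, 150). *)
definition odds_base :: "(nat \<times> nat) list" where
  "odds_base =
    [(65, 1), (13, 1), (7, 3), (35, 1), (21, 1), (7, 1), (5, 3), (15, 1), (5, 1), (3, 3),
     (3, 1), (1, 5), (1, 3), (1, 1)]"

text \<open>Proved by evaluating the search. The values 0 and 1 come from the empty set and from
  {1}.\<close>

lemma square_sums_odds_below_69:
  "set (square_sums 68 odds_below_69 1 0) =
    set (filter (\<lambda>t. t \<in> {0, 1, 9, 10} \<or>
      (t \<ge> 23 \<and> t \<notin> {27, 28, 29, 36, 37, 38, 42, 43, 44, 45, 46, 52, 53, 54, 62, 67, 68}))
      [0..<69])"
  by code_simp

lemma square_sums_odds_base: "set [69..<150] \<subseteq> set (square_sums 149 odds_base 1 0)"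
  by code_simp

lemma squarefree_pair_odds:
  "\<forall>x\<in>set odds_below_69. squarefree_pair x"
  "\<forall>x\<in>set odds_base. squarefree_pair x"
  by (simp_all add: odds_below_69_def odds_base_def squarefree_pair_def squarefree_odd_less_121)

lemma distinct_val_odds:
  "distinct (map val odds_below_69)"
  "distinct (map val odds_base)"
  by code_simp+

lemma val_odds_below_69: "val ` set odds_below_69 = {a. odd a \<and> a < 69}"
proof -
  have "\<forall>x\<in>set odds_below_69. odd (val x) \<and> val x < 69"
    by code_simp
  moreover have "\<forall>a\<in>set [0..<69]. odd a \<longrightarrow> a \<in> set (map val odds_below_69)"
    by code_simp
  ultimately show ?thesis
    by auto
qed

lemma val_odds_base: "\<forall>x\<in>set odds_base. odd (val x) \<and> val x < 81"
  by code_simp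

subsection \<open>The characterisation\<close>

lemma sum_of_distinct_odds_less_69:
  assumes "n < 69"
  shows "sum_of_distinct_odds_with_square_product n \<longleftrightarrow>
    n \<in> {0, 1, 9, 10} \<or>
    (n \<ge> 23 \<and> n \<notin> {27, 28, 29, 36, 37, 38, 42, 43, 44, 45, 46, 52, 53, 54, 62, 67, 68})"
proof -
  have "sum_of_distinct_odds_with_square_product n \<longleftrightarrow>
      (\<exists>A. A \<subseteq> {a. odd a \<and> a < 69} \<and> n = \<Sum>A \<and> n \<le> 68 \<and> is_square (\<Prod>A))"
    (is "_ = ?R")
  proof
    assume "sum_of_distinct_odds_with_square_product n"
    then obtain A where A: "finite A" "\<forall>a\<in>A. odd a" "\<Sum>A = n" "is_square (\<Prod>A)"
      unfolding sum_of_distinct_odds_with_square_product_def by blast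
    \<comment> \<open>A summand is at most the total, so the odd numbers below 69 are the only
      candidates.\<close>
    have "a < 69" if "a \<in> A" for a
      using member_le_sum[of a A "\<lambda>a. a"] that A assms by simp
    then show ?R
      using A assms by (intro exI[of _ A]) auto
  next
    assume ?R
    then obtain A where "A \<subseteq> {a. odd a \<and> a < 69}" "n = \<Sum>A" "is_square (\<Prod>A)"
      by blast
    moreover have "finite {a :: nat. odd a \<and> a < 69}"
      by simp
    ultimately show "sum_of_distinct_odds_with_square_product n"
      unfolding sum_of_distinct_odds_with_square_product_def
      by (intro exI[of _ A]) (auto dest: finite_subset)
  qed
  also have "\<dots> \<longleftrightarrow> n \<in> set (square_sums 68 odds_below_69 1 0)"
    using in_square_sums_iff[OF distinct_val_odds(1) squarefree_pair_odds(1)]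
    by (simp only: val_odds_below_69)
  finally show ?thesis
    unfolding square_sums_odds_below_69 using assms by simp
qed

text \<open>Bounding the summands by the square makes the induction work: the square itself is then
  a new summand, and adding it keeps the product a square.\<close>

lemma distinct_odds_below_square:
  fixes k n :: nat
  assumes "k \<ge> 4" "n \<ge> 69" "n < 69 + (2 * k + 1)\<^sup>2"
  shows "\<exists>A. (\<forall>a\<in>A. odd a \<and> a < (2 * k + 1)\<^sup>2) \<and> \<Sum>A = n \<and> is_square (\<Prod>A)"
  using assms
proof (induction k arbitrary: n rule: nat_induct_at_least)
  case base
  \<comment> \<open>For k = 4 the square is 81, and 69 + 81 = 150.\<close>
  then have "n \<in> set [69..<150]"
    by (simp del: upt_rec_numeral)
  then have "n \<in> set (square_sums 149 odds_base 1 0)"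
    by (rule subsetD[OF square_sums_odds_base])
  then obtain A where A: "A \<subseteq> val ` set odds_base" "n = \<Sum>A" "is_square (\<Prod>A)"
    unfolding in_square_sums_iff[OF distinct_val_odds(2) squarefree_pair_odds(2)]
    by (elim exE conjE)
  have "odd a \<and> a < 81" if "a \<in> A" for a
    using that A(1) val_odds_base by auto
  then show ?case
    using A(2,3) by (intro exI[of _ A]) simp
next
  case (Suc k)
  define q where "q = (2 * k + 1)\<^sup>2"
  have IH: "\<exists>A. (\<forall>a\<in>A. odd a \<and> a < q) \<and> \<Sum>A = m \<and> is_square (\<Prod>A)"
    if "m \<ge> 69" "m < 69 + q" for m
    using Suc.IH that unfolding q_def .
  have q: "odd q" "is_square q"
    by (simp_all add: q_def)
  have next_sq: "(2 * Suc k + 1)\<^sup>2 = q + 8 * k + 8"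
    by (simp add: q_def power2_eq_square algebra_simps)
  have "4 * k \<le> k * k"
    using Suc.hyps by simp
  moreover have "q = 4 * (k * k) + 4 * k + 1"
    by (simp add: q_def power2_eq_square algebra_simps)
  \<comment> \<open>The next odd square is \<open>q + 8 * k + 8\<close>, so this says that it is at
    most \<open>2 * q\<close>. From k >= 4 follows q >= 20 k + 1, which is more than enough.\<close>
  ultimately have q_ge: "8 * k + 8 \<le> q"
    using Suc.hyps by linarith
  have n: "n \<ge> 69" "n < 69 + (q + 8 * k + 8)"
    using Suc.prems unfolding next_sq .
  show ?case
    unfolding next_sq
  proof (cases "n < 69 + q")
    case True
    then obtain A where "\<forall>a\<in>A. odd a \<and> a < q" "\<Sum>A = n" "is_square (\<Prod>A)"
      using IH n(1) by blast
    then show "\<exists>A. (\<forall>a\<in>A. odd a \<and> a < q + 8 * k + 8) \<and> \<Sum>A = n \<and> is_square (\<Prod>A)"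
      by (intro exI[of _ A]) (simp add: trans_less_add1)
  next
    case False
    \<comment> \<open>Since the next square is at most \<open>2 * q\<close>, subtracting
      \<open>q\<close> once lands in the range of the induction hypothesis.\<close>
    then have diff: "n - q \<ge> 69" "n - q < 69 + q"
      using n q_ge by linarith+
    obtain A where A: "\<forall>a\<in>A. odd a \<and> a < q" "\<Sum>A = n - q" "is_square (\<Prod>A)"
      using IH[OF diff] by (elim exE conjE)
    have "finite A"
      using A(1) by (intro finite_subset[of A "{..<q}"]) auto
    moreover have "q \<notin> A"
      using A(1) by blast
    ultimately have "\<Sum>(insert q A) = n" "is_square (\<Prod>(insert q A))"
      using A(2) False is_nth_power_mult[OF q(2) A(3)] by simp_all
    moreover have "\<forall>a\<in>insert q A. odd a \<and> a < q + 8 * k + 8"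
      using A(1) q(1) by (simp add: trans_less_add1)
    ultimately show "\<exists>A. (\<forall>a\<in>A. odd a \<and> a < q + 8 * k + 8) \<and> \<Sum>A = n \<and> is_square (\<Prod>A)"
      by blast
  qed
qed

lemma sum_of_distinct_odds_ge_69:
  assumes "n \<ge> 69"
  shows "sum_of_distinct_odds_with_square_product n"
proof -
  define q where "q = (2 * n + 1)\<^sup>2"
  have "n < 69 + q"
    by (simp add: q_def power2_eq_square)
  \<comment> \<open>The choice k = n makes the square exceed n, so n lies in the range covered by
    the induction.\<close>
  then obtain A where A: "\<forall>a\<in>A. odd a \<and> a < q" "\<Sum>A = n" "is_square (\<Prod>A)"
    using distinct_odds_below_square[of n n] assms unfolding q_def[symmetric] by fastforce
  have "finite A"
    using A(1) by (intro finite_subset[of A "{..<q}"]) auto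
  then show ?thesis
    unfolding sum_of_distinct_odds_with_square_product_def using A by blast
qed

theorem theoremB:
  fixes n :: nat
  assumes "n > 0"
  shows "sum_of_distinct_odds_with_square_product n \<longleftrightarrow>
    n = 1 \<or> n \<in> {9, 10} \<or>
    (n \<ge> 23 \<and>
     n \<notin> {27, 28, 29, 36, 37, 38, 42, 43, 44, 45, 46, 52, 53, 54, 62, 67, 68})"
proof (cases "n < 69")
  case True
  then show ?thesis
    using sum_of_distinct_odds_less_69[OF True] assms by simp
next
  case False
  then show ?thesis
    using sum_of_distinct_odds_ge_69[of n] by simp
qed

end
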